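(* Let $p\in\mathbb{R}$ and consider the equation $$u_t+u_{xxxxx}+t^pu^2u_x=0$$ for $u=u(x,t)$ with $t>0$. Then the pair $$C^0=(5p+2)u,\qquad C^1=\frac{5p+2}{3}t^pu^3+(5p+2)u_{xxxx}$$ is a conserved vector for this equation, i.e. $D_tC^0+D_xC^1=0$ holds on every smooth solution.
   Context: $D_t$ and $D_x$ denote the total derivatives with respect to $t$ and $x$. A conserved vector for an evolution equation is a pair $(C^0,C^1)$ of functions of $x,t,u$ and finitely many derivatives of $u$ such that $D_tC^0+D_xC^1=0$ on all solutions of the equation. *)

theory Defs
  imports "HOL-Analysis.Analysis"
begin

text \<open>
  Coordinates on the infinite jet space of functions \<open>u(x,t)\<close>; \<open>Uc i j\<close> is the coordinate for the
  derivative of \<open>u\<close> taken \<open>i\<close> times in \<open>x\<close> and \<open>j\<close> times in \<open>t\<close>.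
\<close>

datatype jet_coord = Xc | Tc | Uc nat nat

type_synonym jet = "jet_coord \<Rightarrow> real"

definition jet_domain :: "(real \<times> real) set \<Rightarrow> jet set" where
  "jet_domain M = {P. (P Xc, P Tc) \<in> M}"

definition pd :: "jet_coord \<Rightarrow> (jet \<Rightarrow> real) \<Rightarrow> jet \<Rightarrow> real" where
  "pd c F P = deriv (\<lambda>s. F (P(c := s))) (P c)"

text \<open>
  Continuity below refers to the product topology on \<^typ>\<open>jet\<close>; for a function of finitely many
  coordinates this is ordinary joint continuity in those coordinates.
\<close>

primrec jet_Ck :: "nat \<Rightarrow> (real \<times> real) set \<Rightarrow> (jet \<Rightarrow> real) \<Rightarrow> bool" where
  "jet_Ck 0 M F \<longleftrightarrow> continuous_on (jet_domain M) F"
| "jet_Ck (Suc k) M F \<longleftrightarrow> continuous_on (jet_domain M) F \<and>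
     (\<forall>c. (\<forall>P\<in>jet_domain M. (\<lambda>s. F (P(c := s))) differentiable (at (P c))) \<and> jet_Ck k M (pd c F))"

definition finite_order_on :: "(real \<times> real) set \<Rightarrow> (jet \<Rightarrow> real) \<Rightarrow> bool" where
  "finite_order_on M F \<longleftrightarrow> (\<exists>N. \<forall>P\<in>jet_domain M. \<forall>Q\<in>jet_domain M.
     P Xc = Q Xc \<and> P Tc = Q Tc \<and> (\<forall>i j. i + j \<le> N \<longrightarrow> P (Uc i j) = Q (Uc i j)) \<longrightarrow> F P = F Q)"

definition differential_function_on :: "(real \<times> real) set \<Rightarrow> (jet \<Rightarrow> real) \<Rightarrow> bool" where
  "differential_function_on M F \<longleftrightarrow> finite_order_on M F \<and> (\<forall>k. jet_Ck k M F)"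

text \<open>
  The index sets of the sums are finite at every jet over \<open>M\<close> when \<open>F\<close> is of finite order on \<open>M\<close>.
\<close>

definition total_dx :: "(jet \<Rightarrow> real) \<Rightarrow> jet \<Rightarrow> real" where
  "total_dx F P = pd Xc F P +
     (\<Sum>(i, j) \<in> {(i, j). pd (Uc i j) F P \<noteq> 0}. P (Uc (Suc i) j) * pd (Uc i j) F P)"

definition total_dt :: "(jet \<Rightarrow> real) \<Rightarrow> jet \<Rightarrow> real" where
  "total_dt F P = pd Tc F P +
     (\<Sum>(i, j) \<in> {(i, j). pd (Uc i j) F P \<noteq> 0}. P (Uc i (Suc j)) * pd (Uc i j) F P)"

definition partial_x :: "(real \<times> real \<Rightarrow> real) \<Rightarrow> real \<times> real \<Rightarrow> real" where
  "partial_x u z = deriv (\<lambda>y. u (y, snd z)) (fst z)"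

definition partial_t :: "(real \<times> real \<Rightarrow> real) \<Rightarrow> real \<times> real \<Rightarrow> real" where
  "partial_t u z = deriv (\<lambda>s. u (fst z, s)) (snd z)"

primrec Ck_on :: "nat \<Rightarrow> (real \<times> real) set \<Rightarrow> (real \<times> real \<Rightarrow> real) \<Rightarrow> bool" where
  "Ck_on 0 V u \<longleftrightarrow> continuous_on V u"
| "Ck_on (Suc k) V u \<longleftrightarrow> continuous_on V u \<and>
     (\<forall>(x, t)\<in>V. (\<lambda>y. u (y, t)) differentiable (at x) \<and> (\<lambda>s. u (x, s)) differentiable (at t)) \<and>
     Ck_on k V (partial_x u) \<and> Ck_on k V (partial_t u)"

definition smooth_on :: "(real \<times> real) set \<Rightarrow> (real \<times> real \<Rightarrow> real) \<Rightarrow> bool" where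
  "smooth_on V u \<longleftrightarrow> (\<forall>k. Ck_on k V u)"

fun jet_of :: "(real \<times> real \<Rightarrow> real) \<Rightarrow> real \<times> real \<Rightarrow> jet" where
  "jet_of u z Xc = fst z"
| "jet_of u z Tc = snd z"
| "jet_of u z (Uc i j) = (partial_x ^^ i) ((partial_t ^^ j) u) z"

definition smooth_solution_on ::
  "(jet \<Rightarrow> real) \<Rightarrow> (real \<times> real) set \<Rightarrow> (real \<times> real \<Rightarrow> real) \<Rightarrow> bool" where
  "smooth_solution_on E V u \<longleftrightarrow> smooth_on V u \<and> (\<forall>z\<in>V. E (jet_of u z) = 0)"

text \<open>
  \<open>M\<close> is the (open) region of the \<open>(x,t)\<close>-plane on which the equation \<open>E = 0\<close> is considered. Solutions
  may be local, that is, defined on an arbitrary open subset of \<open>M\<close>.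
\<close>

definition conserved_vector ::
  "(real \<times> real) set \<Rightarrow> (jet \<Rightarrow> real) \<Rightarrow> (jet \<Rightarrow> real) \<Rightarrow> (jet \<Rightarrow> real) \<Rightarrow> bool" where
  "conserved_vector M E C0 C1 \<longleftrightarrow>
     differential_function_on M C0 \<and> differential_function_on M C1 \<and>
     (\<forall>V u. open V \<and> V \<subseteq> M \<and> smooth_solution_on E V u \<longrightarrow>
        (\<forall>z\<in>V. total_dt C0 (jet_of u z) + total_dx C1 (jet_of u z) = 0))"

end

theory Submission imports Defs begin

text \<open>
  The pair is conserved with the constant multiplier \<open>5p + 2\<close>: writing \<open>E\<close> for the left-hand side of
  the equation, \<open>D\<^sub>t C\<^sup>0 + D\<^sub>x C\<^sup>1 = (5p + 2) E\<close> holds identically in the jet coordinates.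
\<close>

text \<open>Lying over \<open>M\<close> is decided by the \<open>Xc\<close> and \<open>Tc\<close>
  entries alone, and these vary continuously with \<open>s\<close>, so the admissible
  \<open>s\<close> form an open set around \<open>P c\<close>.\<close>

lemma eventually_jet_domain_update:
  assumes "open M" "P \<in> jet_domain M"
  shows "\<forall>\<^sub>F s in nhds (P c). P(c := s) \<in> jet_domain M"
proof -
  let ?g = "\<lambda>s. ((P(c := s)) Xc, (P(c := s)) Tc)"
  have "continuous_on UNIV ?g"
    by (cases c) (auto intro!: continuous_intros)
  hence "open (?g -` M)"
    using assms(1) by (simp add: continuous_on_open_vimage)
  moreover have "P c \<in> ?g -` M"
    using assms(2) by (simp add: jet_domain_def)
  ultimately show ?thesis
    by (auto simp: eventually_nhds jet_domain_def intro!: exI[of _ "?g -` M"])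
qed

text \<open>A derivative at \<open>P c\<close> sees only nearby values of \<open>s\<close>, and the
  jets reached there still lie over the open set \<open>M\<close>. Agreement over \<open>M\<close>
  is therefore enough, whatever the two functions do elsewhere.\<close>

lemma
  assumes "open M" "\<And>P. P \<in> jet_domain M \<Longrightarrow> F P = G P" "P \<in> jet_domain M"
  shows pd_cong: "pd c F P = pd c G P"
    and jet_differentiable_cong:
      "(\<lambda>s. F (P(c := s))) differentiable (at (P c)) \<Longrightarrow>
       (\<lambda>s. G (P(c := s))) differentiable (at (P c))"
proof -
  have ev: "\<forall>\<^sub>F s in nhds (P c). F (P(c := s)) = G (P(c := s))"
    using eventually_jet_domain_update[OF assms(1,3)]
    by eventually_elim (rule assms(2))
  show "pd c F P = pd c G P"
    unfolding pd_def using ev by (intro deriv_cong_ev) simp_all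
  assume "(\<lambda>s. F (P(c := s))) differentiable (at (P c))"
  then obtain D where "((\<lambda>s. F (P(c := s))) has_real_derivative D) (at (P c))"
    by (auto simp: real_differentiable_def)
  hence "((\<lambda>s. G (P(c := s))) has_real_derivative D) (at (P c))"
    using ev by (subst (asm) DERIV_cong_ev) auto
  thus "(\<lambda>s. G (P(c := s))) differentiable (at (P c))"
    by (auto simp: real_differentiable_def)
qed

text \<open>This allows \<open>pd c F\<close> to be replaced by an explicit formula that is known
  only over \<open>M\<close>. The functions are generalised in the induction because the agreement
  passes to their partial derivatives.\<close>

lemma jet_Ck_cong:
  assumes "open M" "\<And>P. P \<in> jet_domain M \<Longrightarrow> F P = G P" "jet_Ck k M F"
  shows "jet_Ck k M G"
  using assms(2,3)
proof (induction k arbitrary: F G)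
  case 0
  thus ?case by (simp cong: continuous_on_cong)
next
  case (Suc k)
  have "continuous_on (jet_domain M) G"
    using Suc.prems by (simp cong: continuous_on_cong)
  moreover have "jet_Ck k M (pd c G)" for c
    by (rule Suc.IH[of "pd c F"]) (use Suc.prems pd_cong[OF assms(1), of F G] in auto)
  moreover have "(\<lambda>s. G (P(c := s))) differentiable (at (P c))" if "P \<in> jet_domain M" for P c
    by (rule jet_differentiable_cong[OF assms(1), of F]) (use Suc.prems that in auto)
  ultimately show ?case by simp
qed

lemma jet_Ck_SucD: "jet_Ck (Suc k) M F \<Longrightarrow> jet_Ck k M F"
  by (induction k arbitrary: F) auto

lemma pd_eqI:
  "((\<lambda>s. F (P(c := s))) has_real_derivative D) (at (P c)) \<Longrightarrow> pd c F P = D"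
  by (simp add: pd_def DERIV_imp_deriv)

lemma jet_has_derivative_pd:
  assumes "(\<lambda>s. F (P(c := s))) differentiable (at (P c))"
  shows "((\<lambda>s. F (P(c := s))) has_real_derivative pd c F P) (at (P c))"
  using assms by (metis pd_eqI real_differentiable_def)

lemma jet_Ck_const: "jet_Ck k M (\<lambda>P. a)"
proof (induction k arbitrary: a)
  case (Suc k)
  have "pd c (\<lambda>P. a) = (\<lambda>P. 0)" for c
    by (intro ext pd_eqI) simp
  with Suc.IH show ?case by simp
qed simp

lemma jet_coord_has_derivative:
  fixes P :: jet
  shows "((\<lambda>s. (P(c := s)) d) has_real_derivative (if c = d then 1 else 0)) (at x)"
  by auto

lemma pd_coord: "pd c (\<lambda>P. P d) P = (if c = d then 1 else 0)"
  by (intro pd_eqI jet_coord_has_derivative)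

lemma jet_Ck_coord: "jet_Ck k M (\<lambda>P. P d)"
proof (cases k)
  \<comment> \<open>A case split suffices: the derivative of a coordinate is the constant 0 or 1,
    which is already smooth to every order.\<close>
  case (Suc m)
  have "pd c (\<lambda>P. P d) = (\<lambda>P. if c = d then 1 else 0)" for c
    by (intro ext pd_coord)
  moreover have "(\<lambda>s. (P(c := s)) d) differentiable (at (P c))" for P :: jet and c
    using jet_coord_has_derivative real_differentiable_def by blast
  moreover have "continuous_on (jet_domain M) (\<lambda>P. P d)"
    by (auto intro: continuous_on_product_then_coordinatewise)
  ultimately show ?thesis using Suc by (simp add: jet_Ck_const)
qed (auto intro: continuous_on_product_then_coordinatewise)

lemma jet_Ck_add:
  assumes "open M" "jet_Ck k M F" "jet_Ck k M G"
  shows "jet_Ck k M (\<lambda>P. F P + G P)"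
  using assms(2,3)
proof (induction k arbitrary: F G)
  case (Suc k)
  have D: "((\<lambda>s. F (P(c := s)) + G (P(c := s))) has_real_derivative (pd c F P + pd c G P)) (at (P c))"
    if "P \<in> jet_domain M" for P c
    by (intro DERIV_add jet_has_derivative_pd) (use Suc.prems that in auto)
  have "jet_Ck k M (pd c (\<lambda>P. F P + G P))" for c
  \<comment> \<open>The sum rule needs differentiability, which is given only over \<open>M\<close>;
    hence the transfer by congruence.\<close>
  proof (rule jet_Ck_cong[OF assms(1)])
    show "jet_Ck k M (\<lambda>P. pd c F P + pd c G P)"
      using Suc by auto
    show "pd c F P + pd c G P = pd c (\<lambda>P. F P + G P) P" if "P \<in> jet_domain M" for P
      using pd_eqI[OF D[OF that]] by simp
  qed
  thus ?case
    using Suc.prems D by (auto intro!: continuous_intros simp: real_differentiable_def)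
qed (auto intro: continuous_intros)

lemma jet_Ck_mult:
  assumes "open M" "jet_Ck k M F" "jet_Ck k M G"
  shows "jet_Ck k M (\<lambda>P. F P * G P)"
  using assms(2,3)
proof (induction k arbitrary: F G)
  case (Suc k)
  have D: "((\<lambda>s. F (P(c := s)) * G (P(c := s))) has_real_derivative
              (pd c F P * G P + pd c G P * F P)) (at (P c))"
    if "P \<in> jet_domain M" for P c
    using DERIV_mult[OF jet_has_derivative_pd[of F P c] jet_has_derivative_pd[of G P c]]
      Suc.prems that by auto
  have "jet_Ck k M (pd c (\<lambda>P. F P * G P))" for c
  proof (rule jet_Ck_cong[OF assms(1)])
    show "jet_Ck k M (\<lambda>P. pd c F P * G P + pd c G P * F P)"
      \<comment> \<open>The product rule keeps one factor undifferentiated, so \<open>F\<close> and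
        \<open>G\<close> themselves are needed at the lower order \<open>k\<close> as well.\<close>
      using Suc.prems Suc.prems[THEN jet_Ck_SucD]
      by (intro jet_Ck_add[OF assms(1)] Suc.IH) auto
    show "pd c F P * G P + pd c G P * F P = pd c (\<lambda>P. F P * G P) P" if "P \<in> jet_domain M" for P
      using pd_eqI[OF D[OF that]] by simp
  qed
  thus ?case
    using Suc.prems D by (auto intro!: continuous_intros simp: real_differentiable_def)
qed (auto intro: continuous_intros)

lemma jet_Ck_power:
  assumes "open M" "jet_Ck k M F"
  shows "jet_Ck k M (\<lambda>P. F P ^ n)"
  by (induction n) (use assms in \<open>auto intro: jet_Ck_const jet_Ck_mult\<close>)

text \<open>Positivity makes a real power differentiable for every exponent. Differentiating lowers
  the exponent by one, so the induction runs over all \<open>q\<close> at once. It serves for the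
  factor \<open>t^p\<close> on the half-plane.\<close>

lemma jet_Ck_powr_coord:
  assumes "open M" "\<And>P. P \<in> jet_domain M \<Longrightarrow> P d > 0"
  shows "jet_Ck k M (\<lambda>P. P d powr q)"
proof (induction k arbitrary: q)
  case 0
  show ?case
    using jet_Ck_coord[of 0 M d] by (auto intro!: continuous_intros dest!: assms(2))
next
  case (Suc k)
  have D: "((\<lambda>s. (P(c := s)) d powr q) has_real_derivative
              ((if c = d then q else 0) * P d powr (q - 1))) (at (P c))"
    if "P \<in> jet_domain M" for P c
    using has_real_derivative_powr[of "P d" q] assms(2)[OF that] by auto
  have "jet_Ck k M (pd c (\<lambda>P. P d powr q))" for c
  proof (rule jet_Ck_cong[OF assms(1)])
    show "jet_Ck k M (\<lambda>P. (if c = d then q else 0) * P d powr (q - 1))"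
      by (intro jet_Ck_mult[OF assms(1)] jet_Ck_const Suc.IH)
    show "(if c = d then q else 0) * P d powr (q - 1) = pd c (\<lambda>P. P d powr q) P"
      if "P \<in> jet_domain M" for P
      using pd_eqI[OF D[OF that]] by simp
  qed
  moreover have "continuous_on (jet_domain M) (\<lambda>P. P d powr q)"
    using jet_Ck_coord[of 0 M d] by (auto intro!: continuous_intros dest!: assms(2))
  ultimately show ?case
    using D by (auto simp: real_differentiable_def)
qed

text \<open>Enlarging the support to a finite \<open>S\<close> adds only zero terms. An upper bound
  for the support is then enough, which matters because the exact support depends on the jet and on
  whether \<open>5 * p + 2\<close> vanishes.\<close>

lemma total_dx_eq_sum:
  assumes "finite S" "\<And>i j. (i, j) \<notin> S \<Longrightarrow> pd (Uc i j) F P = 0"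
  shows "total_dx F P = pd Xc F P + (\<Sum>(i, j)\<in>S. P (Uc (Suc i) j) * pd (Uc i j) F P)"
  unfolding total_dx_def using assms
  by (intro arg_cong2[where f = "(+)"] refl sum.mono_neutral_left) auto

lemma total_dt_eq_sum:
  assumes "finite S" "\<And>i j. (i, j) \<notin> S \<Longrightarrow> pd (Uc i j) F P = 0"
  shows "total_dt F P = pd Tc F P + (\<Sum>(i, j)\<in>S. P (Uc i (Suc j)) * pd (Uc i j) F P)"
  unfolding total_dt_def using assms
  by (intro arg_cong2[where f = "(+)"] refl sum.mono_neutral_left) auto

theorem mainTheorem4:
  fixes p :: real
  shows "conserved_vector {(x, t). t > 0}
    (\<lambda>P. P (Uc 0 1) + P (Uc 5 0) + P Tc powr p * (P (Uc 0 0))^2 * P (Uc 1 0))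
    (\<lambda>P. (5 * p + 2) * P (Uc 0 0))
    (\<lambda>P. (5 * p + 2) / 3 * P Tc powr p * (P (Uc 0 0))^3 + (5 * p + 2) * P (Uc 4 0))"
proof -
  define M :: "(real \<times> real) set" where "M = {(x, t). t > 0}"
  define a where "a = 5 * p + 2"
  define E :: "jet \<Rightarrow> real" where
    "E = (\<lambda>P. P (Uc 0 1) + P (Uc 5 0) + P Tc powr p * (P (Uc 0 0))^2 * P (Uc 1 0))"
  define C0 :: "jet \<Rightarrow> real" where "C0 = (\<lambda>P. a * P (Uc 0 0))"
  define C1 :: "jet \<Rightarrow> real" where
    "C1 = (\<lambda>P. a / 3 * P Tc powr p * (P (Uc 0 0))^3 + a * P (Uc 4 0))"
  have "M = snd -` {0<..}" by (auto simp: M_def)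
  hence M: "open M" by (auto intro: open_vimage_snd)
  have "finite_order_on M C0"
    unfolding finite_order_on_def C0_def by (intro exI[of _ 0]) auto
  moreover have "jet_Ck k M C0" for k
    unfolding C0_def by (intro jet_Ck_mult[OF M] jet_Ck_const jet_Ck_coord)
  moreover have "finite_order_on M C1"
    \<comment> \<open>The order 4 comes from the term in \<open>u_xxxx\<close>.\<close>
    unfolding finite_order_on_def C1_def by (intro exI[of _ 4]) auto
  moreover have "jet_Ck k M C1" for k
    unfolding C1_def
    by (intro jet_Ck_add[OF M] jet_Ck_mult[OF M] jet_Ck_power[OF M] jet_Ck_powr_coord[OF M]
          jet_Ck_const jet_Ck_coord)
      (auto simp: jet_domain_def M_def)
  moreover have "total_dt C0 (jet_of u z) + total_dx C1 (jet_of u z) = 0"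
    if "E (jet_of u z) = 0" for u z
  proof -
    \<comment> \<open>Naming the jet keeps its entries as independent coordinates, instead of
      letting them unfold into iterated partial derivatives of \<open>u\<close>.\<close>
    define P where "P = jet_of u z"
    have pd0: "pd c C0 P = (if c = Uc 0 0 then a else 0)" for c
      unfolding C0_def by (rule pd_eqI) (auto intro!: derivative_eq_intros)
    \<comment> \<open>The coordinate \<open>Tc\<close> is left out because \<open>total_dx\<close>
      never differentiates in it, so \<open>P Tc powr p\<close> acts as a constant. The factor 1/3
      cancels the 3 from differentiating the cube.\<close>
    have pd1: "pd c C1 P = (if c = Uc 0 0 then a * P Tc powr p * (P (Uc 0 0))^2
        else if c = Uc 4 0 then a else 0)" if "c \<noteq> Tc" for c
      unfolding C1_def using that by (intro pd_eqI) (auto intro!: derivative_eq_intros)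
    have "total_dt C0 P = a * P (Uc 0 1)"
      by (subst total_dt_eq_sum[of "{(0, 0)}"]) (auto simp: pd0)
    moreover have "total_dx C1 P = a * P Tc powr p * (P (Uc 0 0))^2 * P (Uc 1 0) + a * P (Uc 5 0)"
      by (subst total_dx_eq_sum[of "{(0, 0), (4, 0)}"]) (auto simp: pd1 eval_nat_numeral)
    ultimately have "total_dt C0 P + total_dx C1 P = a * E P"
      by (simp add: E_def algebra_simps)
    with that show ?thesis by (simp add: P_def)
  qed
  ultimately have "conserved_vector M E C0 C1"
    unfolding conserved_vector_def differential_function_on_def smooth_solution_on_def by auto
  thus ?thesis
    by (simp only: M_def E_def C0_def C1_def a_def)
qed

end
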